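(* Let $B_{U_t}\in\mathcal B(\mathcal U_t)$ be a Borel set. Suppose for a given collection of independent sample paths $\{x_{t:T}(i),u_{t:T-1}(i)\}_{i=1}^N$ starting from $x_t$ and generated under the reference distribution $R$, the control $u_t$ is computed by the sampling algorithm described in the context, and the probability of $u_t\in B_{U_t}$ given the sample paths is denoted by $\Pr\{u_t\in B_{U_t}\,|\,\{x_{t:T}(i),u_{t:T-1}(i)\}_{i=1}^N\}$. Then, as $N\to\infty$, $$\Pr\{u_t\in B_{U_t}\,|\,\{x_{t:T}(i),u_{t:T-1}(i)\}_{i=1}^N\}\;\overset{a.s.}{\longrightarrow}\;Q^*_{U_t|X_t}(B_{U_t}|x_t).$$
   Context: Time indices are $0,1,\dots,T$; $\mathcal X_t\subseteq\mathbb R^n$, $\mathcal U_t\subseteq\mathbb R^m$ are Borel state and control spaces. The state transition is deterministic: $x_{t+1}=F_t(x_t,u_t)$ with $F_t:\mathcal X_t\times\mathcal U_t\to\mathcal X_{t+1}$, i.e. $P(dx_{t+1}|x_t,u_t)=\delta_{F_t(x_t,u_t)}(dx_{t+1})$. $R_{U_t|X_t}(du_t|x_t)$ is a given reference policy (stochastic kernel). $C_t:\mathcal X_t\times\mathcal U_t\to\mathbb R$ are stage costs, $C_T:\mathcal X_T\to\mathbb R$ a terminal cost, $\lambda>0$, and $C_{t:T}(x_{t:T},u_{t:T-1})=\sum_{k=t}^{T-1}C_k(x_k,u_k)+C_T(x_T)$. The optimal policy $Q^*$ is the minimizer of $\mathbb E_Q\sum_{t=0}^{T-1}\{C_t(X_t,U_t)+\lambda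 D(Q_{U_t|X_t}(\cdot|X_t)\|R_{U_t|X_t}(\cdot|X_t))\}+\mathbb E_QC_T(X_T)$ over stochastic kernels $\{Q_{U_t|X_t}\}$, where $D$ is the Kullback-Leibler divergence; it is given by $Q^*_{U_t|X_t}(B|x_t)=\int_B e^{-\rho_t(x_t,u_t)/\lambda}R(du_t|x_t)\big/\int_{\mathcal U_t}e^{-\rho_t(x_t,u_t)/\lambda}R(du_t|x_t)$ with $\rho_t(x_t,u_t)=C_t(x_t,u_t)+J_{t+1}(F_t(x_t,u_t))$, where $J_T=C_T$ and $J_t(x_t)=-\lambda\log\int_{\mathcal U_t}e^{-\rho_t(x_t,u_t)/\lambda}R(du_t|x_t)$. Sampling algorithm at time $t$ from state $x_t$: draw $N$ independent paths $\{x_{t:T}(i),u_{t:T-1}(i)\}_{i=1}^N$ starting from $x_t$ under $R$ (i.e. $u_k(i)\sim R_{U_k|X_k}(\cdot|x_k(i))$, $x_{k+1}(i)=F_k(x_k(i),u_k(i))$); compute $r_t(i)=\exp(-\frac1\lambda C_{t:T}(x_{t:T}(i),u_{t:T-1}(i)))$ and $r_t=\sum_{i=1}^Nr_t(i)$; draw $d\sim\mathrm{unif}[0,r_t]$; select the index $j_t=\mathsf F_t^{-1}(d)\in\{1,\dots,N\}$, where $\mathsf F_t(x)=\sum_{i=1}^{\lfloor x\rfloor}r_t(i)$ is nondecreasing and piecewise constant on $[0,N]$ and $\mathsf F_t^{-1}(d)$ is its inverse mapping $[0,r_t]\to\{1,\dots,N\}$ (so index $i$ is selected with probability $r_t(i)/r_t$);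 output $u_t=u_t(j_t)$. *)

theory Defs
  imports "HOL-Probability.Probability"
begin

text \<open>
  States live in \<open>X k \<subseteq> real ^ 'n\<close> for \<open>k \<le> T\<close> and controls in
  \<open>U k \<subseteq> real ^ 'm\<close> for \<open>k < T\<close>, both with the trace of the Borel
  sigma-algebra. A sample path \<open>(x\<^sub>t, \<dots>, x\<^sub>k; u\<^sub>t, \<dots>, u\<^sub>k\<^sub>-\<^sub>1)\<close> is a pair of
  (extensional) functions of absolute time.
\<close>

abbreviation trace_borel :: "'a::topological_space set \<Rightarrow> 'a measure"
  where "trace_borel S \<equiv> restrict_space borel S"

type_synonym ('n, 'm) path = "(nat \<Rightarrow> real ^ 'n) \<times> (nat \<Rightarrow> real ^ 'm)"

definition path_space ::
  "(nat \<Rightarrow> (real ^ 'n) set) \<Rightarrow> (nat \<Rightarrow> (real ^ 'm) set) \<Rightarrow> nat \<Rightarrow> nat \<Rightarrow> ('n, 'm) path measure"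
  where "path_space X U t k =
    (\<Pi>\<^sub>M j\<in>{t..k}. trace_borel (X j)) \<Otimes>\<^sub>M (\<Pi>\<^sub>M j\<in>{t..<k}. trace_borel (U j))"

text \<open>
  \<open>path_law X U F R t x n\<close> is the law on \<open>path_space X U t (t + n)\<close> of a path of \<open>n\<close>
  transitions started in state \<open>x\<close> at time \<open>t\<close>: at each time \<open>k\<close> a control is drawn from
  \<open>R k (x k)\<close> and the next state is \<open>F k (x k) (u k)\<close>.
\<close>

primrec path_law ::
  "(nat \<Rightarrow> (real ^ 'n) set) \<Rightarrow> (nat \<Rightarrow> (real ^ 'm) set)
    \<Rightarrow> (nat \<Rightarrow> real ^ 'n \<Rightarrow> real ^ 'm \<Rightarrow> real ^ 'n)
    \<Rightarrow> (nat \<Rightarrow> real ^ 'n \<Rightarrow> (real ^ 'm) measure)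
    \<Rightarrow> nat \<Rightarrow> real ^ 'n \<Rightarrow> nat \<Rightarrow> ('n, 'm) path measure"
  where
    "path_law X U F R t x 0 =
       return (path_space X U t t) (\<lambda>j\<in>{t}. x, \<lambda>j. undefined)"
  | "path_law X U F R t x (Suc n) =
       path_law X U F R t x n \<bind> (\<lambda>(xs, us).
         R (t + n) (xs (t + n)) \<bind> (\<lambda>u.
           return (path_space X U t (t + Suc n))
             (xs(t + Suc n := F (t + n) (xs (t + n)) u), us(t + n := u))))"

definition path_cost ::
  "nat \<Rightarrow> (nat \<Rightarrow> real ^ 'n \<Rightarrow> real ^ 'm \<Rightarrow> real) \<Rightarrow> (real ^ 'n \<Rightarrow> real)
    \<Rightarrow> nat \<Rightarrow> ('n, 'm) path \<Rightarrow> real"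
  where "path_cost T C CT t p =
    (\<Sum>k=t..<T. C k (fst p k) (snd p k)) + CT (fst p T)"

text \<open>
  The value function \<open>J\<close>, by backward recursion from \<open>J T = CT\<close> (values for \<open>k > T\<close> are
  irrelevant). The integral is a Bochner integral, so this is the intended function only where
  the integrand is integrable.
\<close>

function value_fun ::
  "nat \<Rightarrow> real \<Rightarrow> (nat \<Rightarrow> real ^ 'n \<Rightarrow> real ^ 'm \<Rightarrow> real ^ 'n)
    \<Rightarrow> (nat \<Rightarrow> real ^ 'n \<Rightarrow> real ^ 'm \<Rightarrow> real) \<Rightarrow> (real ^ 'n \<Rightarrow> real)
    \<Rightarrow> (nat \<Rightarrow> real ^ 'n \<Rightarrow> (real ^ 'm) measure) \<Rightarrow> nat \<Rightarrow> real ^ 'n \<Rightarrow> real"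
  where
    "value_fun T lam F C CT R k x =
       (if k < T
        then - lam * ln (\<integral>u. exp (- (C k x u + value_fun T lam F C CT R (Suc k) (F k x u)) / lam) \<partial>R k x)
        else CT x)"
  by auto
termination
  by (relation "Wellfounded.measure (\<lambda>(T, _, _, _, _, _, k, _). T - k)") auto

declare value_fun.simps [simp del]

definition rho ::
  "nat \<Rightarrow> real \<Rightarrow> (nat \<Rightarrow> real ^ 'n \<Rightarrow> real ^ 'm \<Rightarrow> real ^ 'n)
    \<Rightarrow> (nat \<Rightarrow> real ^ 'n \<Rightarrow> real ^ 'm \<Rightarrow> real) \<Rightarrow> (real ^ 'n \<Rightarrow> real)
    \<Rightarrow> (nat \<Rightarrow> real ^ 'n \<Rightarrow> (real ^ 'm) measure) \<Rightarrow> nat \<Rightarrow> real ^ 'n \<Rightarrow> real ^ 'm \<Rightarrow> real"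
  where "rho T lam F C CT R k x u = C k x u + value_fun T lam F C CT R (Suc k) (F k x u)"

text \<open>
  The optimal policy of the KL-regularised control problem, as the explicit stochastic kernel
  that minimises the regularised cost. (Minimality alone fixes a kernel only up to states that
  are not visited, so it would not determine the value at a prescribed state.)
\<close>

definition optimal_policy ::
  "nat \<Rightarrow> real \<Rightarrow> (nat \<Rightarrow> real ^ 'n \<Rightarrow> real ^ 'm \<Rightarrow> real ^ 'n)
    \<Rightarrow> (nat \<Rightarrow> real ^ 'n \<Rightarrow> real ^ 'm \<Rightarrow> real) \<Rightarrow> (real ^ 'n \<Rightarrow> real)
    \<Rightarrow> (nat \<Rightarrow> real ^ 'n \<Rightarrow> (real ^ 'm) measure) \<Rightarrow> nat \<Rightarrow> real ^ 'n \<Rightarrow> (real ^ 'm) set \<Rightarrow> real"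
  where "optimal_policy T lam F C CT R k x B =
    (\<integral>u\<in>B. exp (- rho T lam F C CT R k x u / lam) \<partial>R k x)
      / (\<integral>u. exp (- rho T lam F C CT R k x u / lam) \<partial>R k x)"

definition path_weight ::
  "nat \<Rightarrow> real \<Rightarrow> (nat \<Rightarrow> real ^ 'n \<Rightarrow> real ^ 'm \<Rightarrow> real) \<Rightarrow> (real ^ 'n \<Rightarrow> real)
    \<Rightarrow> nat \<Rightarrow> ('n, 'm) path \<Rightarrow> real"
  where "path_weight T lam C CT t p = exp (- (1 / lam) * path_cost T C CT t p)"

definition cum_weight :: "(nat \<Rightarrow> real) \<Rightarrow> real \<Rightarrow> real"
  where "cum_weight r y = (\<Sum>i=1..nat \<lfloor>y\<rfloor>. r i)"

text \<open>
  \<open>cum_weight r\<close> is a step function on \<open>[0, N]\<close>; its inverse mapping is the generalised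
  (left-continuous) inverse with values in \<open>{1..N}\<close>, so that for \<open>d\<close> uniform on
  \<open>[0, r 1 + \<dots> + r N]\<close> index \<open>i\<close> is selected with probability proportional to \<open>r i\<close>.
\<close>

definition select_index :: "(nat \<Rightarrow> real) \<Rightarrow> nat \<Rightarrow> real \<Rightarrow> nat"
  where "select_index r N d = (LEAST i. i \<in> {1..N} \<and> d \<le> cum_weight r (real i))"

text \<open>
  The probability that the algorithm outputs a control in \<open>B\<close>, given the sample paths
  \<open>p 1, \<dots>, p N\<close>: once these are fixed, the only remaining randomness is the draw of \<open>d\<close>.
\<close>

definition sampling_prob ::
  "nat \<Rightarrow> real \<Rightarrow> (nat \<Rightarrow> real ^ 'n \<Rightarrow> real ^ 'm \<Rightarrow> real) \<Rightarrow> (real ^ 'n \<Rightarrow> real)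
    \<Rightarrow> nat \<Rightarrow> nat \<Rightarrow> (nat \<Rightarrow> ('n, 'm) path) \<Rightarrow> (real ^ 'm) set \<Rightarrow> real"
  where "sampling_prob T lam C CT t N p B =
    (let r = (\<lambda>i. path_weight T lam C CT t (p i)) in
      \<P>(d in uniform_measure lborel {0..\<Sum>i=1..N. r i}. snd (p (select_index r N d)) t \<in> B))"

end

theory Submission
  imports Defs
begin

text \<open>
  Given the paths, the control lies in \<open>B\<close> with probability
  \<open>(\<Sum>i. r i * indicator B (u i)) / (\<Sum>i. r i)\<close>; by the strong law of large numbers, numerator and
  denominator, divided by \<open>N\<close>, converge to their expectations under the reference path law. With the
  desirability \<open>Z k = exp (- J k / lam)\<close> the recursion for \<open>J\<close> becomes the linear equation
  \<open>Z k y = \<integral>u. exp (- C k y u / lam) * Z (Suc k) (F k y u) \<partial>R k y\<close>, so integrating out the controls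
  from the last one backwards replaces the weight of a path by \<open>exp (- rho t x u / lam)\<close>.
\<close>

section \<open>The strong law of large numbers\<close>

text \<open>Equals the maximum of the partial sums \<open>\<Sum>i<k. a i\<close> over
  \<open>k \<le> n\<close>, the empty sum included. Peeling off the first term rather than the last
  matches the splitting of a product space into its first coordinate and the rest.\<close>

fun running_max :: "(nat \<Rightarrow> real) \<Rightarrow> nat \<Rightarrow> real" where
  "running_max a 0 = 0"
| "running_max a (Suc n) = max 0 (a 0 + running_max (\<lambda>i. a (Suc i)) n)"

lemma running_max_nonneg: "0 \<le> running_max a n"
  by (cases n) auto

lemma running_max_le_Suc: "running_max a n \<le> running_max a (Suc n)"
proof (induction n arbitrary: a)
  case (Suc n)
  have "running_max (\<lambda>i. a (Suc i)) n \<le> running_max (\<lambda>i. a (Suc i)) (Suc n)"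
    by (rule Suc)
  then show ?case by (auto simp del: running_max.simps(2) simp: running_max.simps(2)[of a])
qed simp

lemma mono_running_max: "mono (running_max a)"
  by (rule incseq_SucI) (rule running_max_le_Suc)

lemma sum_le_running_max: "(\<Sum>i<n. a i) \<le> running_max a n"
proof (induction n arbitrary: a)
  case (Suc n)
  show ?case
    using Suc[of "\<lambda>i. a (Suc i)"] by (simp add: sum.lessThan_Suc_shift del: sum.lessThan_Suc)
qed simp

text \<open>A prepended term shifts all later partial sums by one constant, which cannot affect
  boundedness. This makes divergence of the running maximum an event untouched by the first
  coordinate.\<close>

lemma bdd_above_running_max_shift:
  "bdd_above (range (running_max a)) \<longleftrightarrow> bdd_above (range (running_max (\<lambda>i. a (Suc i))))"
proof
  assume "bdd_above (range (running_max a))"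
  then obtain c where c: "\<And>n. running_max a n \<le> c" by (auto simp: bdd_above_def)
  show "bdd_above (range (running_max (\<lambda>i. a (Suc i))))"
    by (rule bdd_aboveI[of _ "c - a 0"]) (use c[of "Suc _"] in \<open>auto simp: field_simps\<close>)
next
  assume "bdd_above (range (running_max (\<lambda>i. a (Suc i))))"
  then obtain c where c: "\<And>n. running_max (\<lambda>i. a (Suc i)) n \<le> c" by (auto simp: bdd_above_def)
  have "running_max a n \<le> max 0 (a 0 + c)" for n
    using c by (cases n) (auto simp: max.coboundedI2)
  then show "bdd_above (range (running_max a))" by (auto simp: bdd_above_def)
qed

lemma filterlim_running_max:
  assumes "\<not> bdd_above (range (running_max a))"
  shows "filterlim (running_max a) at_top sequentially"
  unfolding filterlim_at_top
proof
  fix c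
  obtain n where n: "c \<le> running_max a n"
    using assms by (auto simp: bdd_above_def not_le intro: less_imp_le)
  show "\<forall>\<^sub>F n in sequentially. c \<le> running_max a n"
    using eventually_ge_at_top[of n]
    by eventually_elim (use n monoD[OF mono_running_max] in \<open>blast intro: order_trans\<close>)
qed

section \<open>Splitting off the first coordinate of an i.i.d. sequence\<close>

context sequence_space
begin

lemma measurable_running_max:
  assumes [measurable]: "f \<in> borel_measurable M"
  shows "(\<lambda>\<omega>. running_max (\<lambda>i. f (\<omega> i)) n) \<in> borel_measurable S"
proof (induction n)
  case (Suc n)
  have shift: "(\<lambda>\<omega> i. \<omega> (Suc i)) \<in> S \<rightarrow>\<^sub>M S"
    by (rule measurable_PiM_single') (auto simp: space_PiM)
  have [measurable]: "(\<lambda>\<omega>. running_max (\<lambda>i. f (\<omega> (Suc i))) n) \<in> borel_measurable S"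
    using measurable_compose[OF shift Suc] by simp
  show ?case by simp
qed simp

text \<open>By \<open>PiM_iter\<close>, \<open>S\<close> is the image of
  \<open>M \<Otimes>\<^sub>M S\<close> under prepending.\<close>

lemma integral_iter:
  fixes h :: "(nat \<Rightarrow> 'a) \<Rightarrow> real"
  assumes "h \<in> borel_measurable S"
  shows "integral\<^sup>L S h = (\<integral>z. h (case_nat (fst z) (snd z)) \<partial>(M \<Otimes>\<^sub>M S))"
    and "integrable S h \<longleftrightarrow> integrable (M \<Otimes>\<^sub>M S) (\<lambda>z. h (case_nat (fst z) (snd z)))"
proof -
  have m: "(\<lambda>(s, \<omega>). case_nat s \<omega>) \<in> M \<Otimes>\<^sub>M S \<rightarrow>\<^sub>M S" by measurable
  show "integral\<^sup>L S h = (\<integral>z. h (case_nat (fst z) (snd z)) \<partial>(M \<Otimes>\<^sub>M S))"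
    using integral_distr[OF m assms] by (simp add: PiM_iter split_beta)
  show "integrable S h \<longleftrightarrow> integrable (M \<Otimes>\<^sub>M S) (\<lambda>z. h (case_nat (fst z) (snd z)))"
    using integrable_distr_eq[OF m assms] by (simp add: PiM_iter split_beta)
qed

text \<open>Fubini; taking either factor to be the constant 1 also covers functions of one
  coordinate alone.\<close>

lemma integral_prod:
  fixes f :: "'a \<Rightarrow> real" and g :: "(nat \<Rightarrow> 'a) \<Rightarrow> real"
  assumes "integrable M f" "integrable S g"
  shows "integrable (M \<Otimes>\<^sub>M S) (\<lambda>z. f (fst z) * g (snd z))"
    and "(\<integral>z. f (fst z) * g (snd z) \<partial>(M \<Otimes>\<^sub>M S)) = integral\<^sup>L M f * integral\<^sup>L S g"
proof -
  interpret MS: pair_sigma_finite M S ..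
  note [measurable] = assms[THEN borel_measurable_integrable]
  show *: "integrable (M \<Otimes>\<^sub>M S) (\<lambda>z. f (fst z) * g (snd z))"
    by (rule MS.Fubini_integrable) (use assms in \<open>auto simp: abs_mult\<close>)
  show "(\<integral>z. f (fst z) * g (snd z) \<partial>(M \<Otimes>\<^sub>M S)) = integral\<^sup>L M f * integral\<^sup>L S g"
    using MS.integral_fst'[OF *] by simp
qed

lemma integrable_running_max:
  assumes f: "integrable M f"
  shows "integrable S (\<lambda>\<omega>. running_max (\<lambda>i. f (\<omega> i)) n)"
proof (induction n)
  case (Suc n)
  note m = measurable_running_max[OF borel_measurable_integrable[OF f]]
  show ?case
    unfolding integral_iter(2)[OF m]
    using integral_prod(1)[OF f, of "\<lambda>_. 1"] integral_prod(1)[OF _ Suc, of "\<lambda>_. 1"]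
    by auto
qed simp

text \<open>
  Garsia's argument. The event \<open>E\<close> that the running maximum diverges does not depend on the first
  coordinate, and on \<open>E\<close> the increment \<open>max 0 (f s + g n \<omega>) - g n \<omega>\<close> tends to \<open>f s\<close>. These increments
  integrate to something nonnegative, so \<open>integral\<^sup>L M f * P.prob E \<ge> 0\<close>.
\<close>

lemma AE_bdd_above_running_max:
  assumes f: "integrable M f" and neg: "integral\<^sup>L M f < 0"
  shows "AE \<omega> in S. bdd_above (range (running_max (\<lambda>i. f (\<omega> i))))"
proof -
  define g where "g n \<omega> = running_max (\<lambda>i. f (\<omega> i)) n" for n \<omega>
  have f_meas [measurable]: "f \<in> borel_measurable M" using f by auto
  have g_meas [measurable]: "g n \<in> borel_measurable S" for n
    unfolding g_def by (rule measurable_running_max) simp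
  have g_int: "integrable S (g n)" for n
    unfolding g_def by (rule integrable_running_max[OF f])
  have g_pos: "0 \<le> g n \<omega>" for n \<omega> by (simp add: g_def running_max_nonneg)
  define E where "E = {\<omega> \<in> space S. \<not> bdd_above (range (\<lambda>n. g n \<omega>))}"
  \<comment> \<open>Natural bounds suffice by the Archimedean property, so \<open>E\<close> is built
    from countably many measurable conditions.\<close>
  have "bdd_above (range (\<lambda>n. g n \<omega>)) \<longleftrightarrow> (\<exists>c::nat. \<forall>n. g n \<omega> \<le> real c)" for \<omega>
    by (auto simp: bdd_above_def) (meson order_trans real_arch_simple)
  then have "E = {\<omega> \<in> space S. \<not> (\<exists>c::nat. \<forall>n. g n \<omega> \<le> real c)}"
    by (simp add: E_def)
  also have "\<dots> \<in> sets S" by measurable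
  finally have E [measurable]: "E \<in> sets S" .
  let ?E = "indicator E :: (nat \<Rightarrow> 'a) \<Rightarrow> real"
  let ?D = "M \<Otimes>\<^sub>M S"
  have E_shift: "?E (case_nat s \<omega>) = ?E \<omega>" if "s \<in> space M" "\<omega> \<in> space S" for s \<omega>
  proof -
    have "case_nat s \<omega> \<in> space S"
      using that by (auto simp: space_PiM PiE_iff split: nat.split)
    then show ?thesis
      using bdd_above_running_max_shift[of "\<lambda>i. f (case_nat s \<omega> i)"] that
      by (auto simp: E_def g_def indicator_def)
  qed
  have int_E: "integrable S (\<lambda>\<omega>. ?E \<omega> * g n \<omega>)" for n
    using integrable_mult_indicator[OF E g_int] by simp
  \<comment> \<open>Splitting off the first coordinate in the expectation of
    \<open>g (Suc n)\<close> exposes the recursion, and \<open>E\<close> survives prepending by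
    \<open>E_shift\<close>. Since \<open>g\<close> grows with \<open>n\<close>, the difference of
    the two expectations on \<open>E\<close> is nonnegative; it takes this form because
    \<open>max 0 (a + b) - b = max (- b) a\<close>.\<close>
  have step: "0 \<le> (\<integral>z. ?E (snd z) * max (- g n (snd z)) (f (fst z)) \<partial>?D)" for n
  proof -
    have i1: "integrable ?D (\<lambda>z. ?E (snd z) * g n (snd z))"
      and e1: "(\<integral>z. ?E (snd z) * g n (snd z) \<partial>?D) = (\<integral>\<omega>. ?E \<omega> * g n \<omega> \<partial>S)"
      using integral_prod[OF _ int_E, of "\<lambda>_. 1"] by (auto simp: M.prob_space)
    have g_Suc: "?E (case_nat (fst z) (snd z)) * g (Suc n) (case_nat (fst z) (snd z))
        = ?E (snd z) * max 0 (f (fst z) + g n (snd z))" if "z \<in> space ?D" for z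
      using E_shift[of "fst z" "snd z"] that by (auto simp: g_def space_pair_measure)
    have m: "(\<lambda>\<omega>. ?E \<omega> * g (Suc n) \<omega>) \<in> borel_measurable S" by measurable
    have e2: "(\<integral>\<omega>. ?E \<omega> * g (Suc n) \<omega> \<partial>S) = (\<integral>z. ?E (snd z) * max 0 (f (fst z) + g n (snd z)) \<partial>?D)"
      unfolding integral_iter(1)[OF m] by (rule Bochner_Integration.integral_cong[OF refl g_Suc])
    have "integrable ?D (\<lambda>z. ?E (case_nat (fst z) (snd z)) * g (Suc n) (case_nat (fst z) (snd z)))
        \<longleftrightarrow> integrable ?D (\<lambda>z. ?E (snd z) * max 0 (f (fst z) + g n (snd z)))"
      by (rule Bochner_Integration.integrable_cong[OF refl g_Suc])
    then have i2: "integrable ?D (\<lambda>z. ?E (snd z) * max 0 (f (fst z) + g n (snd z)))"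
      using int_E[of "Suc n"] unfolding integral_iter(2)[OF m] by blast
    have "(\<integral>\<omega>. ?E \<omega> * g n \<omega> \<partial>S) \<le> (\<integral>\<omega>. ?E \<omega> * g (Suc n) \<omega> \<partial>S)"
      by (intro integral_mono int_E mult_left_mono) (auto simp: g_def running_max_le_Suc simp del: running_max.simps)
    then have "0 \<le> (\<integral>z. ?E (snd z) * max 0 (f (fst z) + g n (snd z)) - ?E (snd z) * g n (snd z) \<partial>?D)"
      unfolding Bochner_Integration.integral_diff[OF i2 i1] e1 e2[symmetric] by simp
    also have "\<dots> = (\<integral>z. ?E (snd z) * max (- g n (snd z)) (f (fst z)) \<partial>?D)"
      by (intro Bochner_Integration.integral_cong) (auto simp: algebra_simps max_def)
    finally show ?thesis .
  qed
  have fE: "integrable ?D (\<lambda>z. f (fst z) * ?E (snd z))"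
    "(\<integral>z. f (fst z) * ?E (snd z) \<partial>?D) = integral\<^sup>L M f * P.prob E"
    using integral_prod[OF f, of ?E] by (auto simp: P.emeasure_eq_measure)
  have "(\<lambda>n. \<integral>z. ?E (snd z) * max (- g n (snd z)) (f (fst z)) \<partial>?D)
      \<longlonglongrightarrow> (\<integral>z. f (fst z) * ?E (snd z) \<partial>?D)"
  proof (rule integral_dominated_convergence[where w = "\<lambda>z. \<bar>f (fst z)\<bar>"])
    show "integrable ?D (\<lambda>z. \<bar>f (fst z)\<bar>)"
      using integral_prod(1)[OF integrable_abs[OF f], of "\<lambda>_. 1"] by simp
    have "(\<lambda>n. ?E \<omega> * max (- g n \<omega>) s) \<longlonglongrightarrow> s * ?E \<omega>" for \<omega> s
    proof (cases "\<omega> \<in> E")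
      case True
      then have "filterlim (\<lambda>n. g n \<omega>) at_top sequentially"
        unfolding E_def g_def by (intro filterlim_running_max) auto
      then have "\<forall>\<^sub>F n in sequentially. - s \<le> g n \<omega>"
        by (simp add: filterlim_at_top)
      then have "\<forall>\<^sub>F n in sequentially. ?E \<omega> * max (- g n \<omega>) s = s * ?E \<omega>"
        by eventually_elim auto
      then show ?thesis by (rule tendsto_eventually)
    qed simp
    then show "AE z in ?D. (\<lambda>n. ?E (snd z) * max (- g n (snd z)) (f (fst z)))
        \<longlonglongrightarrow> f (fst z) * ?E (snd z)" by simp
    \<comment> \<open>The truncation level \<open>- g n\<close> is at most 0 and replaces
      \<open>f\<close> only where \<open>f\<close> lies below it, so absolute values can only
      shrink.\<close>
    show "AE z in ?D. norm (?E (snd z) * max (- g n (snd z)) (f (fst z))) \<le> \<bar>f (fst z)\<bar>" for n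
    proof (intro AE_I2)
      fix z
      show "norm (?E (snd z) * max (- g n (snd z)) (f (fst z))) \<le> \<bar>f (fst z)\<bar>"
        using g_pos[of n "snd z"] by (auto simp: indicator_def max_def)
    qed
  qed measurable
  then have "0 \<le> integral\<^sup>L M f * P.prob E"
    unfolding fE by (rule LIMSEQ_le_const) (use step in auto)
  then have "P.prob E = 0"
    using neg by (simp add: zero_le_mult_iff measure_le_0_iff)
  then have "AE \<omega> in S. \<omega> \<notin> E"
    using P.prob_eq_0 E by blast
  then show ?thesis
    by (auto simp: E_def g_def)
qed

section \<open>From bounded running maxima to convergent averages\<close>

text \<open>For \<open>b\<close> strictly between the mean and \<open>c\<close>,
  \<open>f - b\<close> has negative mean, so its partial sums are bounded by a random
  \<open>d\<close>; the averages of \<open>f\<close> are then at most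
  \<open>b + d / n\<close>.\<close>

lemma AE_eventually_average_less:
  assumes f: "integrable M f" and c: "integral\<^sup>L M f < c"
  shows "AE \<omega> in S. \<forall>\<^sub>F n in sequentially. (\<Sum>i<n. f (\<omega> i)) / n < c"
proof -
  obtain b where b: "integral\<^sup>L M f < b" "b < c" using dense[OF c] by auto
  have "AE \<omega> in S. bdd_above (range (running_max (\<lambda>i. f (\<omega> i) - b)))"
    using f b by (intro AE_bdd_above_running_max) (auto simp: M.prob_space)
  then show ?thesis
  proof eventually_elim
    fix \<omega> assume "bdd_above (range (running_max (\<lambda>i. f (\<omega> i) - b)))"
    then obtain d where d: "\<And>n. running_max (\<lambda>i. f (\<omega> i) - b) n \<le> d"
      by (auto simp: bdd_above_def)
    have sum: "(\<Sum>i<n. f (\<omega> i)) \<le> d + n * b" for n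
      using d[of n] sum_le_running_max[of "\<lambda>i. f (\<omega> i) - b" n] by (simp add: sum_subtractf)
    \<comment> \<open>From \<open>n0\<close> terms on, the accumulated gap \<open>c - b\<close>
      absorbs \<open>d\<close>.\<close>
    obtain n0 where n0: "d < real n0 * (c - b)"
      using reals_Archimedean3[of "c - b"] b(2) by auto
    show "\<forall>\<^sub>F n in sequentially. (\<Sum>i<n. f (\<omega> i)) / n < c"
      using eventually_ge_at_top[of n0] eventually_gt_at_top[of 0]
    proof eventually_elim
      fix n :: nat assume n: "n0 \<le> n" "0 < n"
      have "real n0 * (c - b) \<le> real n * (c - b)"
        using n b by (intro mult_right_mono) auto
      then have "(\<Sum>i<n. f (\<omega> i)) < n * c"
        using sum[of n] n0 by (simp add: algebra_simps)
      then show "(\<Sum>i<n. f (\<omega> i)) / n < c"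
        using n by (simp add: field_simps)
    qed
  qed
qed

text \<open>The one-sided bound is applied to \<open>f\<close> and to \<open>- f\<close>, with
  countably many tolerances \<open>1 / Suc k\<close> so that the exceptional null sets can be
  united.\<close>

theorem strong_law_of_large_numbers:
  fixes f :: "'a \<Rightarrow> real"
  assumes f: "integrable M f"
  shows "AE \<omega> in S. (\<lambda>n. (\<Sum>i<n. f (\<omega> i)) / n) \<longlonglongrightarrow> integral\<^sup>L M f"
proof -
  let ?m = "integral\<^sup>L M f"
  have "AE \<omega> in S. \<forall>k. \<forall>\<^sub>F n in sequentially. (\<Sum>i<n. f (\<omega> i)) / n < ?m + 1 / Suc k"
    unfolding AE_all_countable by (intro allI AE_eventually_average_less f) simp
  moreover have "AE \<omega> in S. \<forall>k. \<forall>\<^sub>F n in sequentially. (\<Sum>i<n. - f (\<omega> i)) / n < - ?m + 1 / Suc k"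
    unfolding AE_all_countable
    by (intro allI AE_eventually_average_less) (use f in auto)
  ultimately show ?thesis
  proof eventually_elim
    fix \<omega>
    assume up: "\<forall>k. \<forall>\<^sub>F n in sequentially. (\<Sum>i<n. f (\<omega> i)) / n < ?m + 1 / Suc k"
      and lo: "\<forall>k. \<forall>\<^sub>F n in sequentially. (\<Sum>i<n. - f (\<omega> i)) / n < - ?m + 1 / Suc k"
    show "(\<lambda>n. (\<Sum>i<n. f (\<omega> i)) / n) \<longlonglongrightarrow> ?m"
    proof (rule tendstoI)
      fix e :: real assume "0 < e"
      then obtain k where k: "1 / Suc k < e" using nat_approx_posE by blast
      show "\<forall>\<^sub>F n in sequentially. dist ((\<Sum>i<n. f (\<omega> i)) / n) ?m < e"
        using up[THEN spec, of k] lo[THEN spec, of k]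
        by eventually_elim (use k in \<open>auto simp: dist_real_def sum_negf\<close>)
    qed
  qed
qed

end

section \<open>Transfer to independent random variables\<close>

text \<open>Independence and the common law make the joint law of \<open>Y 1\<close>,
  \<open>Y 2\<close>, ... an infinite power of \<open>P\<close>, so almost sure statements on the
  sequence space pull back to \<open>M\<close>.\<close>

lemma (in prob_space) strong_law_indep_vars:
  fixes f :: "'b \<Rightarrow> real"
  assumes indep: "indep_vars (\<lambda>_. N) Y {1::nat..}"
    and law: "\<And>i. 1 \<le> i \<Longrightarrow> distr M N (Y i) = P"
    and f: "integrable P f"
  shows "AE \<omega> in M. (\<lambda>n. (\<Sum>i=1..n. f (Y i \<omega>)) / n) \<longlonglongrightarrow> integral\<^sup>L P f"
proof -
  have Y [measurable]: "Y i \<in> M \<rightarrow>\<^sub>M N" if "1 \<le> i" for i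
    using indep that by (auto simp: indep_vars_def)
  have P: "prob_space P" and sets_eq: "sets P = sets N"
    using prob_space_distr[OF Y, of 1] law[of 1, symmetric] by auto
  interpret PP: prob_space P by (rule P)
  interpret SP: sequence_space P ..
  \<comment> \<open>The variables are indexed from 1 and the sequence space from 0;
    \<open>Suc\<close> reindexes \<open>?K\<close> into \<open>?S\<close>.\<close>
  let ?S = "\<Pi>\<^sub>M i\<in>(UNIV::nat set). P"
  let ?K = "\<Pi>\<^sub>M i\<in>{1::nat..}. P"
  have sets_K: "sets (\<Pi>\<^sub>M i\<in>{1::nat..}. N) = sets ?K"
    by (rule sets_PiM_cong) (rule refl, rule sets_eq[symmetric])
  have Y_K: "(\<lambda>\<omega>. \<lambda>i\<in>{1..}. Y i \<omega>) \<in> M \<rightarrow>\<^sub>M ?K"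
    unfolding measurable_cong_sets[OF refl sets_K[symmetric]]
    by (rule measurable_restrict) simp
  have "distr M ?K (\<lambda>\<omega>. \<lambda>i\<in>{1..}. Y i \<omega>)
      = distr M (\<Pi>\<^sub>M i\<in>{1..}. N) (\<lambda>\<omega>. \<lambda>i\<in>{1..}. Y i \<omega>)"
    by (rule distr_cong[OF refl sets_K[symmetric] refl])
  also have "\<dots> = (\<Pi>\<^sub>M i\<in>{1..}. distr M N (Y i))"
    using indep by (subst (asm) indep_vars_iff_distr_eq_PiM') auto
  also have "\<dots> = ?K"
    by (rule PiM_cong) (simp_all add: law)
  finally have distr_K: "distr M ?K (\<lambda>\<omega>. \<lambda>i\<in>{1..}. Y i \<omega>) = ?K" .
  have "distr ?K ?S (\<lambda>\<omega>. \<lambda>n\<in>UNIV. \<omega> (Suc n)) = ?S"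
    by (rule distr_PiM_reindex[where M = "\<lambda>_. P"]) (auto simp: P)
  then have distr_S: "distr ?K ?S (\<lambda>\<omega> n. \<omega> (Suc n)) = ?S" by (simp add: restrict_UNIV)
  have shift: "(\<lambda>\<omega> n. \<omega> (Suc n)) \<in> ?K \<rightarrow>\<^sub>M ?S"
    by (rule measurable_PiM_single') (auto simp: space_PiM PiE_iff)
  have "AE \<omega> in distr ?K ?S (\<lambda>\<omega> n. \<omega> (Suc n)). (\<lambda>n. (\<Sum>i<n. f (\<omega> i)) / n) \<longlonglongrightarrow> integral\<^sup>L P f"
    unfolding distr_S by (rule SP.strong_law_of_large_numbers[OF f])
  from AE_distrD[OF shift this]
  have "AE \<omega> in distr M ?K (\<lambda>\<omega>. \<lambda>i\<in>{1..}. Y i \<omega>).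
      (\<lambda>n. (\<Sum>i<n. f (\<omega> (Suc i))) / n) \<longlonglongrightarrow> integral\<^sup>L P f"
    unfolding distr_K .
  from AE_distrD[OF Y_K this] show ?thesis
    by (simp add: sum.atLeast1_atMost_eq)
qed

section \<open>The selected index\<close>

lemma cum_weight_of_nat: "cum_weight r (real i) = (\<Sum>j=1..i. r j)"
  by (simp add: cum_weight_def)

text \<open>Cumulative weights cut the interval into half-open cells, and the least index reaching
  \<open>d\<close> is that of the cell containing it. The point \<open>d = 0\<close> is excluded: it
  selects index 1 but lies in no cell.\<close>

lemma select_index_eq_iff:
  assumes pos: "\<And>i. 0 < r i" and d: "0 < d" "d \<le> (\<Sum>j=1..N. r j)" and i: "i \<in> {1..N}"
  shows "select_index r N d = i \<longleftrightarrow> d \<in> {(\<Sum>j=1..i-1. r j)<..(\<Sum>j=1..i. r j)}"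
proof -
  define c where "c k = (\<Sum>j=1..k. r j)" for k
  have c_mono: "k \<le> l \<Longrightarrow> c k \<le> c l" for k l
    unfolding c_def by (rule sum_mono2) (auto intro: less_imp_le pos)
  let ?P = "\<lambda>k. k \<in> {1..N} \<and> d \<le> c k"
  have sel: "select_index r N d = (LEAST k. ?P k)"
    by (simp add: select_index_def cum_weight_of_nat c_def)
  have "?P N" using d i by (auto simp: c_def)
  then have P: "?P (LEAST k. ?P k)" by (rule LeastI)
  show ?thesis
    unfolding sel c_def[symmetric]
  proof
    assume *: "(LEAST k. ?P k) = i"
    \<comment> \<open>For \<open>i = 1\<close> the lower endpoint is the empty sum and
      \<open>0 < d\<close> suffices; otherwise \<open>i - 1\<close> is a smaller admissible index
      that the minimum passed over.\<close>
    have "c (i - 1) < d"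
    proof (cases "i = 1")
      case False
      then have "\<not> ?P (i - 1)" using not_less_Least[of "i - 1" ?P] * i by auto
      then show ?thesis using False i by auto
    qed (use d in \<open>simp add: c_def\<close>)
    then show "d \<in> {c (i - 1)<..c i}" using P * by auto
  next
    assume *: "d \<in> {c (i - 1)<..c i}"
    show "(LEAST k. ?P k) = i"
    proof (rule Least_equality)
      fix k assume k: "?P k"
      have "\<not> k \<le> i - 1" using c_mono[of k "i - 1"] k * by auto
      then show "i \<le> k" by simp
    qed (use * i in auto)
  qed
qed

text \<open>Cell \<open>i\<close> has length \<open>r i\<close>, so normalised Lebesgue measure
  gives index \<open>i\<close> its share of the total weight; the shares of the indices satisfying
  \<open>Q\<close> add up.\<close>

lemma prob_select_index:
  assumes pos: "\<And>i. 0 < r i" and N: "1 \<le> N"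
  shows "\<P>(d in uniform_measure lborel {0..\<Sum>i=1..N. r i}. Q (select_index r N d))
    = (\<Sum>i=1..N. r i * indicator {i. Q i} i) / (\<Sum>i=1..N. r i)"
proof -
  define c where "c k = (\<Sum>j=1..k. r j)" for k
  have c_mono: "k \<le> l \<Longrightarrow> c k \<le> c l" for k l
    unfolding c_def by (rule sum_mono2) (auto intro: less_imp_le pos)
  have c_step: "c i = c (i - 1) + r i" if "i \<in> {1..N}" for i
    using that by (cases i) (auto simp: c_def)
  have cN: "0 < c N"
    unfolding c_def using N pos by (intro sum_pos) auto
  let ?I = "{i \<in> {1..N}. Q i}"
  let ?A = "{d. Q (select_index r N d)}"
  have A [measurable]: "?A \<in> sets borel"
    unfolding select_index_def by measurable
  have sel: "select_index r N d = i \<longleftrightarrow> d \<in> {c (i - 1)<..c i}"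
    if "0 < d" "d \<le> c N" "i \<in> {1..N}" for d i
    using select_index_eq_iff[OF pos] that by (simp add: c_def)
  have range: "select_index r N d \<in> {1..N}" if "0 < d" "d \<le> c N" for d
    unfolding select_index_def
    by (rule LeastI2[of _ N]) (use that N in \<open>auto simp: cum_weight_of_nat c_def\<close>)
  \<comment> \<open>With the point 0 removed, the event is a disjoint union of whole cells.\<close>
  have union: "{0<..c N} \<inter> ?A = (\<Union>i\<in>?I. {c (i - 1)<..c i})"
  proof (intro set_eqI iffI)
    fix d assume "d \<in> {0<..c N} \<inter> ?A"
    then show "d \<in> (\<Union>i\<in>?I. {c (i - 1)<..c i})"
      using sel[of d "select_index r N d"] range[of d] by auto
  next
    fix d assume "d \<in> (\<Union>i\<in>?I. {c (i - 1)<..c i})"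
    then obtain i where i: "i \<in> {1..N}" "Q i" "d \<in> {c (i - 1)<..c i}" by auto
    have "0 \<le> c (i - 1)" "c i \<le> c N" using c_mono[of 0 "i - 1"] c_mono[of i N] i by (auto simp: c_def)
    then have "0 < d" "d \<le> c N" using i by auto
    then show "d \<in> {0<..c N} \<inter> ?A" using sel[of d i] i by auto
  qed
  have disj: "disjoint_family_on (\<lambda>i. {c (i - 1)<..c i}) ?I"
  proof -
    have "{c (i - 1)<..c i} \<inter> {c (j - 1)<..c j} = {}" if "i < j" for i j
      proof -
      have "i \<le> j - 1" using that by simp
      from c_mono[OF this] show ?thesis by auto
    qed
    then show ?thesis
      by (auto simp: disjoint_family_on_def) (metis Int_iff empty_iff greaterThanAtMost_iff linorder_neqE_nat)
  qed
  \<comment> \<open>The removed endpoint is a null set.\<close>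
  have "measure lborel ({0..c N} \<inter> ?A) = measure lborel ({0<..c N} \<inter> ?A)"
  proof (rule measure_eq_AE)
    have "AE d in lborel. d \<noteq> (0::real)" by (rule AE_lborel_singleton)
    then show "AE d in lborel. (d \<in> {0..c N} \<inter> ?A) = (d \<in> {0<..c N} \<inter> ?A)"
      by eventually_elim auto
  qed auto
  also have "\<dots> = (\<Sum>i\<in>?I. measure lborel {c (i - 1)<..c i})"
    unfolding union
    by (rule measure_finite_Union[OF _ _ disj]) (auto simp: c_mono)
  also have "\<dots> = (\<Sum>i\<in>?I. r i)"
    using pos by (intro sum.cong refl, subst measure_lborel_Ioc) (auto simp: c_mono c_step less_imp_le)
  also have "\<dots> = (\<Sum>i=1..N. r i * indicator {i. Q i} i)"
    unfolding sum.inter_filter[OF finite_atLeastAtMost] by (rule sum.cong) auto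

  finally have num: "measure lborel ({0..c N} \<inter> ?A) = (\<Sum>i=1..N. r i * indicator {i. Q i} i)" .
  have "measure lborel {0..c N} = c N" using cN by simp
  moreover have "measure (uniform_measure lborel {0..c N}) ?A
      = measure lborel ({0..c N} \<inter> ?A) / measure lborel {0..c N}"
    by (rule measure_uniform_measure) (use cN in auto)
  ultimately have "measure (uniform_measure lborel {0..c N}) ?A
      = (\<Sum>i=1..N. r i * indicator {i. Q i} i) / c N"
    unfolding num by simp
  then show ?thesis by (simp add: c_def)
qed

section \<open>Expected path weights\<close>

text \<open>\<open>value_finite\<close> guarantees that from time \<open>t\<close> on each Bochner
  integral in the value recursion is a genuine one, not the default 0.\<close>

locale kl_control =
  fixes T :: nat
    and X :: "nat \<Rightarrow> (real ^ 'n) set"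
    and U :: "nat \<Rightarrow> (real ^ 'm) set"
    and F :: "nat \<Rightarrow> real ^ 'n \<Rightarrow> real ^ 'm \<Rightarrow> real ^ 'n"
    and R :: "nat \<Rightarrow> real ^ 'n \<Rightarrow> (real ^ 'm) measure"
    and C :: "nat \<Rightarrow> real ^ 'n \<Rightarrow> real ^ 'm \<Rightarrow> real"
    and CT :: "real ^ 'n \<Rightarrow> real"
    and lam :: real
    and t :: nat
  assumes F_meas: "\<And>k. k < T \<Longrightarrow> (\<lambda>(x, u). F k x u)
        \<in> trace_borel (X k) \<Otimes>\<^sub>M trace_borel (U k) \<rightarrow>\<^sub>M trace_borel (X (Suc k))"
    and R_kernel: "\<And>k. k < T \<Longrightarrow> R k \<in> trace_borel (X k) \<rightarrow>\<^sub>M prob_algebra (trace_borel (U k))"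
    and C_meas: "\<And>k. k < T \<Longrightarrow> (\<lambda>(x, u). C k x u)
        \<in> borel_measurable (trace_borel (X k) \<Otimes>\<^sub>M trace_borel (U k))"
    and CT_meas: "CT \<in> borel_measurable (trace_borel (X T))"
    and lam_pos: "lam > 0"
    and value_finite: "\<And>k y. t \<le> k \<Longrightarrow> k < T \<Longrightarrow> y \<in> X k \<Longrightarrow>
        integrable (R k y) (\<lambda>u. exp (- rho T lam F C CT R k y u / lam))"
begin

section \<open>Reference kernels and the linear recursion\<close>

lemma prob_space_R: "k < T \<Longrightarrow> y \<in> X k \<Longrightarrow> prob_space (R k y)"
  and sets_R: "k < T \<Longrightarrow> y \<in> X k \<Longrightarrow> sets (R k y) = sets (trace_borel (U k))"
  using measurable_space[OF R_kernel, of k y] by (auto simp: space_prob_algebra space_restrict_space)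

lemma space_R: "k < T \<Longrightarrow> y \<in> X k \<Longrightarrow> space (R k y) = U k"
  using sets_eq_imp_space_eq[OF sets_R] by (simp add: space_restrict_space)

text \<open>The Cole-Hopf transform of the value function, positive by construction.\<close>

definition desirability :: "nat \<Rightarrow> real ^ 'n \<Rightarrow> real"
  where "desirability k y = exp (- value_fun T lam F C CT R k y / lam)"

lemma exp_rho: "exp (- rho T lam F C CT R k y u / lam) = exp (- C k y u / lam) * desirability (Suc k) (F k y u)"
  by (simp add: rho_def desirability_def exp_add[symmetric] add_divide_distrib diff_divide_distrib)

lemma desirability_eq:
  assumes "t \<le> k" "k < T" "y \<in> X k"
  shows "desirability k y = (\<integral>u. exp (- rho T lam F C CT R k y u / lam) \<partial>R k y)" (is "_ = ?I")
proof -
  interpret prob_space "R k y" using assms by (intro prob_space_R)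
  \<comment> \<open>\<open>exp\<close> undoes \<open>ln\<close> only on positive numbers; a strictly
    positive integrand over a probability space has a strictly positive integral.\<close>
  have "(\<integral>u. 0 \<partial>R k y) < ?I"
    by (rule integral_less_AE_space[OF _ value_finite[OF assms]]) (auto simp: emeasure_space_1)
  then show ?thesis
    using assms lam_pos
    by (simp add: desirability_def value_fun.simps[of T lam F C CT R k] rho_def)
qed

text \<open>The linear recursion in nonnegative form, where the rules for bind need measurability
  but no integrability.\<close>

lemma nn_integral_rho:
  assumes "t \<le> k" "k < T" "y \<in> X k"
  shows "(\<integral>\<^sup>+u. ennreal (exp (- C k y u / lam) * desirability (Suc k) (F k y u)) \<partial>R k y) = ennreal (desirability k y)"
  using nn_integral_eq_integral[OF value_finite[OF assms]]
  unfolding exp_rho[symmetric] desirability_eq[OF assms] by simp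

lemma measurable_step_weight:
  assumes "desirability (Suc k) \<in> borel_measurable (trace_borel (X (Suc k)))" "k < T"
  shows "(\<lambda>(y, u). ennreal (exp (- C k y u / lam) * desirability (Suc k) (F k y u)))
    \<in> borel_measurable (trace_borel (X k) \<Otimes>\<^sub>M trace_borel (U k))"
proof -
  have "(\<lambda>z. desirability (Suc k) (F k (fst z) (snd z))) \<in> borel_measurable (trace_borel (X k) \<Otimes>\<^sub>M trace_borel (U k))"
    using measurable_compose[OF F_meas[OF assms(2)] assms(1)] by (simp add: split_beta)
  moreover have "(\<lambda>z. C k (fst z) (snd z)) \<in> borel_measurable (trace_borel (X k) \<Otimes>\<^sub>M trace_borel (U k))"
    using C_meas[OF assms(2)] by (simp add: split_beta)
  ultimately show ?thesis by (simp add: split_beta)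
qed

text \<open>Backward induction from the terminal cost: integrating a jointly measurable weight
  against the kernel \<open>R k\<close> leaves a measurable function of the state.\<close>

lemma measurable_desirability:
  assumes "t \<le> k" "k \<le> T"
  shows "desirability k \<in> borel_measurable (trace_borel (X k))"
  using assms(2,1)
proof (induction rule: inc_induct)
  case base
  have "desirability T = (\<lambda>y. exp (- CT y / lam))" by (simp add: desirability_def value_fun.simps fun_eq_iff)
  then show ?case using CT_meas by simp
next
  case (step k)
  have "(\<lambda>y. \<integral>\<^sup>+u. ennreal (exp (- C k y u / lam) * desirability (Suc k) (F k y u)) \<partial>R k y)
      \<in> borel_measurable (trace_borel (X k))"
    using step by (intro nn_integral_measurable_subprob_algebra2[OF measurable_step_weight]
        measurable_prob_algebraD R_kernel) auto
  then have "(\<lambda>y. ennreal (desirability k y)) \<in> borel_measurable (trace_borel (X k))"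
    by (rule measurable_cong[THEN iffD1, rotated])
      (rule nn_integral_rho, use step in \<open>auto simp: space_restrict_space\<close>)
  \<comment> \<open>\<open>enn2real\<close> inverts \<open>ennreal\<close> here because the
    desirability is nonnegative.\<close>
  then have "(\<lambda>y. enn2real (ennreal (desirability k y))) \<in> borel_measurable (trace_borel (X k))"
    by measurable
  then show ?case by (simp add: desirability_def)
qed

section \<open>Extending paths by one transition\<close>

text \<open>The update in the \<open>Suc\<close> clause of \<open>path_law\<close>, isolated so that
  its measurability is settled once.\<close>

definition extend :: "nat \<Rightarrow> ('n, 'm) path \<Rightarrow> real ^ 'm \<Rightarrow> ('n, 'm) path"
  where "extend k p u = ((fst p)(Suc k := F k (fst p k) u), (snd p)(k := u))"

lemma measurable_state: "j \<in> {t..k} \<Longrightarrow> (\<lambda>p. fst p j) \<in> path_space X U t k \<rightarrow>\<^sub>M trace_borel (X j)"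
  unfolding path_space_def by (rule measurable_compose[OF measurable_fst]) (rule measurable_component_singleton)

lemma measurable_control: "j \<in> {t..<k} \<Longrightarrow> (\<lambda>p. snd p j) \<in> path_space X U t k \<rightarrow>\<^sub>M trace_borel (U j)"
  unfolding path_space_def by (rule measurable_compose[OF measurable_snd]) (rule measurable_component_singleton)

lemma state_in: "p \<in> space (path_space X U t k) \<Longrightarrow> j \<in> {t..k} \<Longrightarrow> fst p j \<in> X j"
  using measurable_space[OF measurable_state, of j k p] by (auto simp: space_restrict_space)

lemma control_in: "p \<in> space (path_space X U t k) \<Longrightarrow> j \<in> {t..<k} \<Longrightarrow> snd p j \<in> U j"
  using measurable_space[OF measurable_control, of j k p] by (auto simp: space_restrict_space)

lemma measurable_extend:
  assumes k: "t \<le> k" "k < T"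
  shows "(\<lambda>(p, u). extend k p u)
    \<in> path_space X U t k \<Otimes>\<^sub>M trace_borel (U k) \<rightarrow>\<^sub>M path_space X U t (Suc k)"
proof -
  let ?D = "path_space X U t k \<Otimes>\<^sub>M trace_borel (U k)"
  have fst: "(\<lambda>z. fst (fst z)) \<in> ?D \<rightarrow>\<^sub>M (\<Pi>\<^sub>M j\<in>{t..k}. trace_borel (X j))"
    and snd: "(\<lambda>z. snd (fst z)) \<in> ?D \<rightarrow>\<^sub>M (\<Pi>\<^sub>M j\<in>{t..<k}. trace_borel (U j))"
    unfolding path_space_def by measurable
  have F: "(\<lambda>z. F k (fst (fst z) k) (snd z)) \<in> ?D \<rightarrow>\<^sub>M trace_borel (X (Suc k))"
    using measurable_compose[OF measurable_Pair[OF measurable_compose[OF measurable_fst measurable_state] measurable_snd] F_meas]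
      k by simp
  \<comment> \<open>Each index set gains one point, so both function updates are instances of
    \<open>measurable_add_dim\<close>.\<close>
  have "{t..Suc k} = insert (Suc k) {t..k}" "{t..<Suc k} = insert k {t..<k}" using k by auto
  then have "(\<lambda>z. extend k (fst z) (snd z)) \<in> ?D \<rightarrow>\<^sub>M path_space X U t (Suc k)"
    unfolding extend_def path_space_def[of X U t "Suc k"]
    using measurable_compose[OF measurable_Pair[OF fst F] measurable_add_dim]
      measurable_compose[OF measurable_Pair[OF snd measurable_snd] measurable_add_dim]
    by (intro measurable_Pair) simp_all
  then show ?thesis by (simp add: split_beta)
qed

text \<open>A Markov kernel on histories, which turns \<open>path_law\<close> into an iterated
  bind.\<close>

definition step_law :: "nat \<Rightarrow> ('n, 'm) path \<Rightarrow> ('n, 'm) path measure"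
  where "step_law k p = R k (fst p k) \<bind> (\<lambda>u. return (path_space X U t (Suc k)) (extend k p u))"

lemma path_law_Suc: "path_law X U F R t x (Suc n) = path_law X U F R t x n \<bind> step_law (t + n)"
  by (simp add: step_law_def[abs_def] extend_def case_prod_beta')

lemma measurable_step_law:
  assumes k: "t \<le> k" "k < T"
  shows "step_law k \<in> path_space X U t k \<rightarrow>\<^sub>M prob_algebra (path_space X U t (Suc k))"
  unfolding step_law_def[abs_def]
proof (rule measurable_bind_prob_space2)
  show "(\<lambda>p. R k (fst p k)) \<in> path_space X U t k \<rightarrow>\<^sub>M prob_algebra (trace_borel (U k))"
    using measurable_compose[OF measurable_state R_kernel] k by simp
  show "(\<lambda>(p, u). return (path_space X U t (Suc k)) (extend k p u))
      \<in> path_space X U t k \<Otimes>\<^sub>M trace_borel (U k) \<rightarrow>\<^sub>M prob_algebra (path_space X U t (Suc k))"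
    using measurable_compose[OF measurable_extend[OF k] measurable_return_prob_space]
    by (simp add: split_beta)
qed

text \<open>Binding averages over the control, and the point mass left by \<open>return\<close>
  evaluates \<open>h\<close> at the extended path.\<close>

lemma nn_integral_step_law:
  assumes k: "t \<le> k" "k < T" and p: "p \<in> space (path_space X U t k)"
    and h: "h \<in> borel_measurable (path_space X U t (Suc k))"
  shows "(\<integral>\<^sup>+q. h q \<partial>step_law k p) = (\<integral>\<^sup>+u. h (extend k p u) \<partial>R k (fst p k))"
proof -
  have in_X: "fst p k \<in> X k" using state_in[OF p] k by simp
  have ext: "extend k p \<in> R k (fst p k) \<rightarrow>\<^sub>M path_space X U t (Suc k)"
    unfolding measurable_cong_sets[OF sets_R[OF k(2) in_X] refl]
    using measurable_compose[OF measurable_Pair1'[OF p] measurable_extend[OF k]] by simp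
  have "(\<integral>\<^sup>+q. h q \<partial>step_law k p)
      = (\<integral>\<^sup>+u. (\<integral>\<^sup>+q. h q \<partial>return (path_space X U t (Suc k)) (extend k p u)) \<partial>R k (fst p k))"
    unfolding step_law_def
    by (rule nn_integral_bind[OF h measurable_compose[OF ext return_measurable]])
  also have "\<dots> = (\<integral>\<^sup>+u. h (extend k p u) \<partial>R k (fst p k))"
    using h measurable_space[OF ext] by (intro nn_integral_cong nn_integral_return) auto
  finally show ?thesis .
qed

text \<open>Supplies the normalisation and the sigma-algebra on which the later bind and integral
  rules rely; the horizon bound keeps every kernel within its range of definition.\<close>

lemma path_law_in_prob_algebra:
  assumes x: "x \<in> X t" and "t + n \<le> T"
  shows "path_law X U F R t x n \<in> space (prob_algebra (path_space X U t (t + n)))"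
  using assms(2)
proof (induction n)
  case 0
  have "(\<lambda>j\<in>{t}. x, \<lambda>j. undefined) \<in> space (path_space X U t t)"
    using x by (auto simp: path_space_def space_pair_measure space_PiM space_restrict_space)
  then show ?case
    by (auto simp: space_prob_algebra prob_space_return)
next
  case (Suc n)
  have D: "path_law X U F R t x n \<in> space (prob_algebra (path_space X U t (t + n)))"
    using Suc by simp
  have K: "step_law (t + n) \<in> path_space X U t (t + n) \<rightarrow>\<^sub>M prob_algebra (path_space X U t (t + Suc n))"
    using measurable_step_law[of "t + n"] Suc.prems by simp
  show ?case
    unfolding path_law_Suc using prob_space_bind'[OF D K] sets_bind'[OF D K]
    by (simp add: space_prob_algebra)
qed

text \<open>Tower property: given the path before its last transition, only the last control remains
  to be integrated.\<close>

lemma nn_integral_path_law_Suc: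
  assumes x: "x \<in> X t" and n: "t + n < T"
    and h: "h \<in> borel_measurable (path_space X U t (Suc (t + n)))"
  shows "(\<integral>\<^sup>+q. h q \<partial>path_law X U F R t x (Suc n))
    = (\<integral>\<^sup>+p. (\<integral>\<^sup>+u. h (extend (t + n) p u) \<partial>R (t + n) (fst p (t + n))) \<partial>path_law X U F R t x n)"
proof -
  have D: "path_law X U F R t x n \<in> space (prob_algebra (path_space X U t (t + n)))"
    using path_law_in_prob_algebra[OF x] n by simp
  then have sets: "sets (path_law X U F R t x n) = sets (path_space X U t (t + n))"
    by (simp add: space_prob_algebra)
  have K: "step_law (t + n) \<in> path_law X U F R t x n \<rightarrow>\<^sub>M subprob_algebra (path_space X U t (Suc (t + n)))"
    unfolding measurable_cong_sets[OF sets refl]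
    using n by (intro measurable_prob_algebraD measurable_step_law) auto
  show ?thesis
    unfolding path_law_Suc nn_integral_bind[OF h K]
    using n by (intro nn_integral_cong nn_integral_step_law h)
      (auto simp: sets_eq_imp_space_eq[OF sets])
qed

section \<open>The martingale of desirability weights\<close>

text \<open>The weight accumulated before time \<open>k\<close>, with \<open>desirability k\<close>
  standing for the expected weight of the remainder. At \<open>k = T\<close> it is the path weight
  times the indicator that the first control lies in \<open>B\<close>.\<close>

definition desirability_weight :: "(real ^ 'm) set \<Rightarrow> nat \<Rightarrow> ('n, 'm) path \<Rightarrow> real"
  where "desirability_weight B k p = indicator B (snd p t) * exp (- (\<Sum>j=t..<k. C j (fst p j) (snd p j)) / lam) * desirability k (fst p k)"

lemma measurable_desirability_weight:
  assumes k: "t < k" "k \<le> T" and B: "B \<in> sets (trace_borel (U t))"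
  shows "desirability_weight B k \<in> borel_measurable (path_space X U t k)"
proof -
  have "(\<lambda>p. C j (fst p j) (snd p j)) \<in> borel_measurable (path_space X U t k)" if "j \<in> {t..<k}" for j
    using measurable_compose[OF measurable_Pair[OF measurable_state[of j k] measurable_control[of j k]] C_meas[of j]] that k
    by simp
  moreover have "(\<lambda>p. desirability k (fst p k)) \<in> borel_measurable (path_space X U t k)"
    using measurable_compose[OF measurable_state measurable_desirability] k by simp
  moreover have "(\<lambda>p. indicator B (snd p t) :: real) \<in> borel_measurable (path_space X U t k)"
    using measurable_compose[OF measurable_control borel_measurable_indicator[OF B]] k by simp
  ultimately show ?thesis
    unfolding desirability_weight_def[abs_def] by measurable
qed

text \<open>An extension leaves earlier states and controls intact, so the new factor is one step of
  the linear recursion. For \<open>k = t\<close> the control just drawn is the one tested against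
  \<open>B\<close>; later that control is already recorded in \<open>p\<close>.\<close>

lemma desirability_weight_extend:
  assumes "t \<le> k"
  shows "desirability_weight B (Suc k) (extend k p u) = (if k = t then indicator B u else indicator B (snd p t))
    * exp (- (\<Sum>j=t..<k. C j (fst p j) (snd p j)) / lam)
    * (exp (- C k (fst p k) u / lam) * desirability (Suc k) (F k (fst p k) u))"
proof -
  have "(\<Sum>j=t..<k. C j (fst (extend k p u) j) (snd (extend k p u) j))
      = (\<Sum>j=t..<k. C j (fst p j) (snd p j))"
    by (rule sum.cong) (auto simp: extend_def)
  then have "(\<Sum>j=t..<Suc k. C j (fst (extend k p u) j) (snd (extend k p u) j))
      = (\<Sum>j=t..<k. C j (fst p j) (snd p j)) + C k (fst p k) u"
    using assms by (simp add: extend_def)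
  then show ?thesis
    unfolding desirability_weight_def by (simp add: extend_def exp_add[symmetric] add_divide_distrib diff_divide_distrib)
qed

text \<open>
  Under the reference path law the weights form a martingale in \<open>n \<ge> 1\<close>, so the terminal
  expectation can be computed after the first step.
\<close>

lemma nn_integral_desirability_weight:
  assumes x: "x \<in> X t" and B: "B \<in> sets (trace_borel (U t))" and n: "t + Suc n \<le> T"
  shows "(\<integral>\<^sup>+p. ennreal (desirability_weight B (t + Suc n) p) \<partial>path_law X U F R t x (Suc n))
    = (\<integral>\<^sup>+u. ennreal (indicator B u * exp (- rho T lam F C CT R t x u / lam)) \<partial>R t x)"
  using n
proof (induction n)
  case 0
  \<comment> \<open>The first control exists only after one transition. Before it the path law is a
    point mass at the single-state path \<open>?p\<close>, so only the integral over that control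
    remains.\<close>
  let ?p = "(\<lambda>j\<in>{t}. x, \<lambda>j. undefined)"
  let ?g = "\<lambda>p. \<integral>\<^sup>+u. ennreal (desirability_weight B (Suc t) (extend t p u)) \<partial>R t (fst p t)"
  have p: "?p \<in> space (path_space X U t t)"
    using x by (auto simp: path_space_def space_pair_measure space_PiM space_restrict_space)
  have h: "(\<lambda>p. ennreal (desirability_weight B (Suc t) p)) \<in> borel_measurable (path_space X U t (Suc t))"
    using measurable_desirability_weight[OF _ _ B, of "Suc t"] 0 by simp
  have g: "?g \<in> borel_measurable (path_space X U t t)"
  proof (rule nn_integral_measurable_subprob_algebra2)
    show "(\<lambda>(p, u). ennreal (desirability_weight B (Suc t) (extend t p u)))
        \<in> borel_measurable (path_space X U t t \<Otimes>\<^sub>M trace_borel (U t))"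
      using measurable_compose[OF measurable_extend h] 0 by (simp add: split_beta)
    show "(\<lambda>p. R t (fst p t)) \<in> path_space X U t t \<rightarrow>\<^sub>M subprob_algebra (trace_borel (U t))"
      using measurable_compose[OF measurable_state[of t t] R_kernel[of t]] 0
      by (intro measurable_prob_algebraD) simp
  qed
  have "(\<integral>\<^sup>+p. ennreal (desirability_weight B (t + Suc 0) p) \<partial>path_law X U F R t x (Suc 0))
      = (\<integral>\<^sup>+p. ?g p \<partial>path_law X U F R t x 0)"
    using nn_integral_path_law_Suc[OF x, of 0] h 0 by simp
  also have "\<dots> = ?g ?p"
    using nn_integral_return[OF p g] by simp
  also have "\<dots> = (\<integral>\<^sup>+u. ennreal (indicator B u * exp (- rho T lam F C CT R t x u / lam)) \<partial>R t x)"
    unfolding exp_rho by (simp add: desirability_weight_extend mult.assoc)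
  finally show ?case .
next
  case (Suc n)
  let ?k = "t + Suc n"
  have D: "path_law X U F R t x (Suc n) \<in> space (prob_algebra (path_space X U t ?k))"
    using path_law_in_prob_algebra[OF x, of "Suc n"] Suc.prems by (simp del: path_law.simps)
  then have space: "space (path_law X U F R t x (Suc n)) = space (path_space X U t ?k)"
    by (auto simp: space_prob_algebra dest: sets_eq_imp_space_eq)
  have h: "(\<lambda>p. ennreal (desirability_weight B (Suc ?k) p)) \<in> borel_measurable (path_space X U t (Suc ?k))"
    using measurable_desirability_weight[OF _ _ B, of "Suc ?k"] Suc.prems by simp
  have "(\<integral>\<^sup>+p. ennreal (desirability_weight B (t + Suc (Suc n)) p) \<partial>path_law X U F R t x (Suc (Suc n)))
      = (\<integral>\<^sup>+p. (\<integral>\<^sup>+u. ennreal (desirability_weight B (Suc ?k) (extend ?k p u)) \<partial>R ?k (fst p ?k)) \<partial>path_law X U F R t x (Suc n))"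
    using nn_integral_path_law_Suc[OF x _ h] Suc.prems by (simp del: path_law.simps)
  also have "\<dots> = (\<integral>\<^sup>+p. ennreal (desirability_weight B ?k p) \<partial>path_law X U F R t x (Suc n))"
  proof (rule nn_integral_cong)
    fix p assume "p \<in> space (path_law X U F R t x (Suc n))"
    then have p: "fst p ?k \<in> X ?k" using state_in[of p ?k ?k] space by simp
    \<comment> \<open>\<open>a\<close> collects the factors fixed by the path so far, including the
      indicator since \<open>?k > t\<close>; the rest integrates to \<open>desirability ?k\<close>
      by the linear recursion.\<close>
    define a where "a = indicator B (snd p t) * exp (- (\<Sum>j=t..<?k. C j (fst p j) (snd p j)) / lam)"
    have a: "0 \<le> a" by (simp add: a_def)
    let ?w = "\<lambda>u. exp (- C ?k (fst p ?k) u / lam) * desirability (Suc ?k) (F ?k (fst p ?k) u)"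
    have w: "(\<lambda>u. ennreal (?w u)) \<in> borel_measurable (R ?k (fst p ?k))"
      using borel_measurable_integrable[OF value_finite[of ?k "fst p ?k"]] p Suc.prems
      unfolding exp_rho[symmetric] by simp
    have "(\<integral>\<^sup>+u. ennreal (desirability_weight B (Suc ?k) (extend ?k p u)) \<partial>R ?k (fst p ?k))
        = (\<integral>\<^sup>+u. ennreal a * ennreal (?w u) \<partial>R ?k (fst p ?k))"
      using a by (simp add: desirability_weight_extend a_def ennreal_mult' desirability_def)
    also have "\<dots> = ennreal a * ennreal (desirability ?k (fst p ?k))"
      using nn_integral_cmult[OF w] nn_integral_rho[of ?k "fst p ?k"] p Suc.prems by simp
    also have "\<dots> = ennreal (desirability_weight B ?k p)"
      using a by (simp add: desirability_weight_def a_def ennreal_mult')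
    finally show "(\<integral>\<^sup>+u. ennreal (desirability_weight B (Suc ?k) (extend ?k p u)) \<partial>R ?k (fst p ?k)) = ennreal (desirability_weight B ?k p)" .
  qed
  also have "\<dots> = (\<integral>\<^sup>+u. ennreal (indicator B u * exp (- rho T lam F C CT R t x u / lam)) \<partial>R t x)"
    using Suc by (simp del: path_law.simps)
  finally show ?case .
qed

text \<open>The terminal case of the martingale identity, carried back to Bochner integrals;
  finiteness of the right-hand side gives the integrability that the law of large numbers asks
  for.\<close>

lemma path_weight_integral:
  assumes x: "x \<in> X t" and B: "B \<in> sets (trace_borel (U t))" and t: "t < T"
  defines "h \<equiv> \<lambda>p. path_weight T lam C CT t p * indicator B (snd p t)"
  shows "integrable (path_law X U F R t x (T - t)) h"
    and "integral\<^sup>L (path_law X U F R t x (T - t)) h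
      = (\<integral>u\<in>B. exp (- rho T lam F C CT R t x u / lam) \<partial>R t x)"
proof -
  let ?D = "path_law X U F R t x (T - t)"
  let ?e = "\<lambda>u. exp (- rho T lam F C CT R t x u / lam)"
  have h_eq: "h p = desirability_weight B T p" for p
    by (simp add: h_def desirability_weight_def path_weight_def path_cost_def desirability_def value_fun.simps
        exp_add[symmetric] add_divide_distrib diff_divide_distrib)
  have sets_D: "sets ?D = sets (path_space X U t T)"
    using path_law_in_prob_algebra[OF x, of "T - t"] t by (simp add: space_prob_algebra)
  have meas: "h \<in> borel_measurable ?D"
    unfolding measurable_cong_sets[OF sets_D refl] h_eq[abs_def]
    using measurable_desirability_weight[OF t _ B] by simp
  have pos: "0 \<le> h p" for p by (simp add: h_def path_weight_def)
  have B': "B \<in> sets (R t x)" using sets_R[OF t x] B by simp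
  have int: "integrable (R t x) (\<lambda>u. indicator B u * ?e u)"
    using integrable_mult_indicator[OF B' value_finite[OF order_refl t x]] by simp
  \<comment> \<open>A path to the horizon has \<open>T - t = Suc (T - t - 1)\<close> transitions, at
    least one because \<open>t < T\<close>.\<close>
  have "(\<integral>\<^sup>+p. ennreal (h p) \<partial>?D) = (\<integral>\<^sup>+u. ennreal (indicator B u * ?e u) \<partial>R t x)"
    using nn_integral_desirability_weight[OF x B, of "T - t - 1"] t by (simp add: h_eq Suc_diff_Suc del: path_law.simps)
  also have "\<dots> = ennreal (\<integral>u. indicator B u * ?e u \<partial>R t x)"
    by (rule nn_integral_eq_integral[OF int]) simp
  finally have *: "(\<integral>\<^sup>+p. ennreal (h p) \<partial>?D) = ennreal (\<integral>u\<in>B. ?e u \<partial>R t x)"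
    by (simp add: set_lebesgue_integral_def)
  have "0 \<le> (\<integral>u\<in>B. ?e u \<partial>R t x)"
    by (simp add: set_lebesgue_integral_def)
  with nn_integral_eq_integrable[OF meas _ this] * pos
  show "integrable ?D h" "integral\<^sup>L ?D h = (\<integral>u\<in>B. ?e u \<partial>R t x)" by auto
qed

end

section \<open>Almost sure convergence of the sampling probability\<close>

theorem theorem13:
  fixes T t :: nat
    and X :: "nat \<Rightarrow> (real ^ 'n) set"
    and U :: "nat \<Rightarrow> (real ^ 'm) set"
    and F :: "nat \<Rightarrow> real ^ 'n \<Rightarrow> real ^ 'm \<Rightarrow> real ^ 'n"
    and R :: "nat \<Rightarrow> real ^ 'n \<Rightarrow> (real ^ 'm) measure"
    and C :: "nat \<Rightarrow> real ^ 'n \<Rightarrow> real ^ 'm \<Rightarrow> real"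
    and CT :: "real ^ 'n \<Rightarrow> real"
    and lam :: real
    and x :: "real ^ 'n"
    and B :: "(real ^ 'm) set"
    and M :: "'w measure"
    and paths :: "nat \<Rightarrow> 'w \<Rightarrow> ('n, 'm) path"
  assumes X_borel: "\<And>k. k \<le> T \<Longrightarrow> X k \<in> sets borel"
    and U_borel: "\<And>k. k < T \<Longrightarrow> U k \<in> sets borel"
    and F_meas: "\<And>k. k < T \<Longrightarrow> (\<lambda>(x, u). F k x u)
        \<in> trace_borel (X k) \<Otimes>\<^sub>M trace_borel (U k) \<rightarrow>\<^sub>M trace_borel (X (Suc k))"
    and R_kernel: "\<And>k. k < T \<Longrightarrow> R k \<in> trace_borel (X k) \<rightarrow>\<^sub>M prob_algebra (trace_borel (U k))"
    and C_meas: "\<And>k. k < T \<Longrightarrow> (\<lambda>(x, u). C k x u)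
        \<in> borel_measurable (trace_borel (X k) \<Otimes>\<^sub>M trace_borel (U k))"
    and CT_meas: "CT \<in> borel_measurable (trace_borel (X T))"
    and lam_pos: "lam > 0"
    and t_less: "t < T"
    and x_in: "x \<in> X t"
    and value_finite: "\<And>k y. t \<le> k \<Longrightarrow> k < T \<Longrightarrow> y \<in> X k \<Longrightarrow>
        integrable (R k y) (\<lambda>u. exp (- rho T lam F C CT R k y u / lam))"
    and B_borel: "B \<in> sets (trace_borel (U t))"
    and M_prob: "prob_space M"
    and paths_indep: "prob_space.indep_vars M (\<lambda>_. path_space X U t T) paths {1..}"
    and paths_law: "\<And>i. 1 \<le> i \<Longrightarrow>
        distr M (path_space X U t T) (paths i) = path_law X U F R t x (T - t)"
  shows "AE \<omega> in M. (\<lambda>N. sampling_prob T lam C CT t N (\<lambda>i. paths i \<omega>) B)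
           \<longlonglongrightarrow> optimal_policy T lam F C CT R t x B"
proof -
  interpret prob_space M by (rule M_prob)
  interpret kl_control T X U F R C CT lam t
    by unfold_locales (fact F_meas R_kernel C_meas CT_meas lam_pos value_finite)+
  let ?D = "path_law X U F R t x (T - t)"
  let ?r = "path_weight T lam C CT t"
  let ?e = "\<lambda>u. exp (- rho T lam F C CT R t x u / lam)"
  have r_pos: "0 < ?r p" for p by (simp add: path_weight_def)
  \<comment> \<open>Used with \<open>A = B\<close> for the numerator and with \<open>A = U t\<close>
    for the denominator.\<close>
  have lln: "AE \<omega> in M. (\<lambda>N. (\<Sum>i=1..N. ?r (paths i \<omega>) * indicator A (snd (paths i \<omega>) t)) / N)
      \<longlonglongrightarrow> (\<integral>u\<in>A. ?e u \<partial>R t x)" if "A \<in> sets (trace_borel (U t))" for A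
    using strong_law_indep_vars[OF paths_indep paths_law path_weight_integral(1)[OF x_in that t_less]]
    unfolding path_weight_integral(2)[OF x_in that t_less] .
  have U_sets: "U t \<in> sets (trace_borel (U t))"
    using sets.top[of "trace_borel (U t)"] by (simp add: space_restrict_space)
  have total: "(\<integral>u\<in>U t. ?e u \<partial>R t x) = (\<integral>u. ?e u \<partial>R t x)"
    unfolding space_R[OF t_less x_in, symmetric] set_integral_space[OF value_finite[OF order_refl t_less x_in]] ..
  \<comment> \<open>The integral is the desirability at \<open>x\<close>, an exponential, so the
    limits may be divided.\<close>
  have total_pos: "(\<integral>u. ?e u \<partial>R t x) \<noteq> 0"
    unfolding desirability_eq[OF order_refl t_less x_in, symmetric] by (simp add: desirability_def)
  have "AE \<omega> in M. \<forall>i\<in>{1..}. paths i \<omega> \<in> space (path_space X U t T)"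
    using paths_indep by (intro AE_I2) (auto simp: indep_vars_def dest: measurable_space)
  with lln[OF B_borel] lln[OF U_sets] show ?thesis
  proof eventually_elim
    fix \<omega>
    let ?p = "\<lambda>i. paths i \<omega>"
    assume num: "(\<lambda>N. (\<Sum>i=1..N. ?r (?p i) * indicator B (snd (?p i) t)) / N) \<longlonglongrightarrow> (\<integral>u\<in>B. ?e u \<partial>R t x)"
      and den: "(\<lambda>N. (\<Sum>i=1..N. ?r (?p i) * indicator (U t) (snd (?p i) t)) / N) \<longlonglongrightarrow> (\<integral>u\<in>U t. ?e u \<partial>R t x)"
      and space: "\<forall>i\<in>{1..}. ?p i \<in> space (path_space X U t T)"
    \<comment> \<open>First controls of paths lie in \<open>U t\<close>, so the indicator is
      constantly 1 and the total weight remains.\<close>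
    have weights: "(\<Sum>i=1..N. ?r (?p i) * indicator (U t) (snd (?p i) t)) = (\<Sum>i=1..N. ?r (?p i))" for N
      using space control_in[of "paths _ \<omega>" T t] t_less by (intro sum.cong) auto
    have "(\<lambda>N. (\<Sum>i=1..N. ?r (?p i)) / N) \<longlonglongrightarrow> (\<integral>u. ?e u \<partial>R t x)"
      using den unfolding weights total .
    from tendsto_divide[OF num this total_pos]
    have lim: "(\<lambda>N. (\<Sum>i=1..N. ?r (?p i) * indicator B (snd (?p i) t)) / N / ((\<Sum>i=1..N. ?r (?p i)) / N))
        \<longlonglongrightarrow> optimal_policy T lam F C CT R t x B"
      by (simp add: optimal_policy_def)
    \<comment> \<open>For \<open>N \<ge> 1\<close> the factors \<open>1 / N\<close> cancel, leaving
      the probability of selecting an index whose control lies in \<open>B\<close>.\<close>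
    have "\<forall>\<^sub>F N in sequentially.
        (\<Sum>i=1..N. ?r (?p i) * indicator B (snd (?p i) t)) / N / ((\<Sum>i=1..N. ?r (?p i)) / N)
        = sampling_prob T lam C CT t N ?p B"
      using eventually_ge_at_top[of 1]
    proof eventually_elim
      fix N :: nat assume N: "1 \<le> N"
      have "sampling_prob T lam C CT t N ?p B
          = (\<Sum>i=1..N. ?r (?p i) * indicator {i. snd (?p i) t \<in> B} i) / (\<Sum>i=1..N. ?r (?p i))"
        unfolding sampling_prob_def Let_def
        by (rule prob_select_index[OF r_pos N])
      then show "(\<Sum>i=1..N. ?r (?p i) * indicator B (snd (?p i) t)) / N / ((\<Sum>i=1..N. ?r (?p i)) / N)
          = sampling_prob T lam C CT t N ?p B"
        using N by (simp add: indicator_def)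
    qed
    then show "(\<lambda>N. sampling_prob T lam C CT t N ?p B) \<longlonglongrightarrow> optimal_policy T lam F C CT R t x B"
      by (rule Lim_transform_eventually[OF lim])
  qed
qed

end
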